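(* Let $(X,d)$ be a compact metric space and let $f_n: X\to X$ be continuous for each $n\geq 0$. Then the system $x_{n+1}=f_n(x_n)$, $n\ge 0$, is Li-Yorke $\delta$-chaotic for some $\delta>0$ if and only if it is distributionally $\delta'$-chaotic in a sequence for some $\delta'>0$ (i.e. there exist $\delta'>0$ and an increasing sequence $Q\subset\mathbf{N}$ such that the system is distributionally $\delta'$-chaotic in $Q$).
   Context: $\mathbf{N}$ denotes the set of nonnegative integers. For maps $f_n:X\to X$ ($n\ge0$), $f_0^0$ is the identity map on $X$ and $f_0^n:=f_{n-1}\circ\cdots\circ f_0$ for $n\ge1$. "Increasing sequence" means a strictly increasing infinite sequence. For an increasing sequence $P=\{p_n\}_{n=1}^\infty\subset\mathbf{N}$, $x,y\in X$ and $\epsilon>0$, set $$F^*_{x,y}(\epsilon,P)=\limsup_{n\to\infty}\frac1n\sum_{i=1}^n\chi_{[0,\epsilon)}\big(d(f_0^{p_i}(x),f_0^{p_i}(y))\big),\qquad F_{x,y}(\epsilon,P)=\liminf_{n\to\infty}\frac1n\sum_{i=1}^n\chi_{[0,\epsilon)}\big(d(f_0^{p_i}(x),f_0^{p_i}(y))\big),$$ where $\chi_{[0,\epsilon)}$ is the characteristic function of $[0,\epsilon)$. Let $\delta>0$. A set $D\subset X$ with at least two points is a distributionally $\delta$-scrambled set in the sequence $P$ if for all $x,y\in D$ with $x\ne y$: $F^*_{x,y}(\epsilon,P)=1$ for every $\epsilon>0$, and $F_{x,y}(\delta,P)=0$. The system is distributionally $\delta$-chaotic in the sequence $P$ if it has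 an uncountable distributionally $\delta$-scrambled set in $P$. A set $S\subset X$ with at least two points is a Li-Yorke $\delta$-scrambled set if for all $x,y\in S$ with $x\neq y$: $\liminf_{n\to\infty}d(f_0^n(x),f_0^n(y))=0$ and $\limsup_{n\to\infty}d(f_0^n(x),f_0^n(y))>\delta$. The system is Li-Yorke $\delta$-chaotic if it has an uncountable Li-Yorke $\delta$-scrambled set. *)

theory Defs
  imports "HOL-Analysis.Analysis"
begin

text \<open>The time-\<open>n\<close> map \<open>f\<^sub>0\<^sup>n = f\<^sub>n\<^sub>-\<^sub>1 \<circ> \<dots> \<circ> f\<^sub>0\<close> of the nonautonomous
  system \<open>x\<^sub>n\<^sub>+\<^sub>1 = f\<^sub>n(x\<^sub>n)\<close>.\<close>

primrec time_map :: "(nat \<Rightarrow> 'a \<Rightarrow> 'a) \<Rightarrow> nat \<Rightarrow> 'a \<Rightarrow> 'a" where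
  "time_map f 0 = id"
| "time_map f (Suc n) = f n \<circ> time_map f n"

text \<open>A sequence \<open>P = {p\<^sub>1 < p\<^sub>2 < \<dots>}\<close> of nonnegative integers is a function indexed from 0, so that
  \<open>p i\<close> stands for \<open>p\<^sub>i\<^sub>+\<^sub>1\<close> and the sum over \<open>i < n\<close> runs over \<open>p\<^sub>1, \<dots>, p\<^sub>n\<close>. Indexing from 1 with
  an unused \<open>p 0\<close> would, for a strictly monotone \<open>p\<close>, exclude \<open>p\<^sub>1 = 0\<close>.
  At \<open>n = 0\<close> the average is 0 by convention, which does not affect the limits below.\<close>

definition closeness_average ::
  "(nat \<Rightarrow> 'a::metric_space \<Rightarrow> 'a) \<Rightarrow> (nat \<Rightarrow> nat) \<Rightarrow> 'a \<Rightarrow> 'a \<Rightarrow> real \<Rightarrow> nat \<Rightarrow> real" where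
  "closeness_average f p x y \<epsilon> n =
     1 / real n * (\<Sum>i<n. indicator {0..<\<epsilon>} (dist (time_map f (p i) x) (time_map f (p i) y)))"

definition upper_distribution ::
  "(nat \<Rightarrow> 'a::metric_space \<Rightarrow> 'a) \<Rightarrow> (nat \<Rightarrow> nat) \<Rightarrow> 'a \<Rightarrow> 'a \<Rightarrow> real \<Rightarrow> ereal" where
  "upper_distribution f p x y \<epsilon> = limsup (\<lambda>n. ereal (closeness_average f p x y \<epsilon> n))"

definition lower_distribution ::
  "(nat \<Rightarrow> 'a::metric_space \<Rightarrow> 'a) \<Rightarrow> (nat \<Rightarrow> nat) \<Rightarrow> 'a \<Rightarrow> 'a \<Rightarrow> real \<Rightarrow> ereal" where
  "lower_distribution f p x y \<epsilon> = liminf (\<lambda>n. ereal (closeness_average f p x y \<epsilon> n))"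

definition distributionally_scrambled ::
  "'a::metric_space set \<Rightarrow> (nat \<Rightarrow> 'a \<Rightarrow> 'a) \<Rightarrow> real \<Rightarrow> (nat \<Rightarrow> nat) \<Rightarrow> 'a set \<Rightarrow> bool" where
  "distributionally_scrambled X f \<delta> p D \<longleftrightarrow>
     D \<subseteq> X \<and> (\<exists>x\<in>D. \<exists>y\<in>D. x \<noteq> y) \<and>
     (\<forall>x\<in>D. \<forall>y\<in>D. x \<noteq> y \<longrightarrow>
        (\<forall>\<epsilon>>0. upper_distribution f p x y \<epsilon> = 1) \<and> lower_distribution f p x y \<delta> = 0)"

definition distributionally_chaotic ::
  "'a::metric_space set \<Rightarrow> (nat \<Rightarrow> 'a \<Rightarrow> 'a) \<Rightarrow> real \<Rightarrow> (nat \<Rightarrow> nat) \<Rightarrow> bool" where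
  "distributionally_chaotic X f \<delta> p \<longleftrightarrow>
     (\<exists>D. uncountable D \<and> distributionally_scrambled X f \<delta> p D)"

definition Li_Yorke_scrambled ::
  "'a::metric_space set \<Rightarrow> (nat \<Rightarrow> 'a \<Rightarrow> 'a) \<Rightarrow> real \<Rightarrow> 'a set \<Rightarrow> bool" where
  "Li_Yorke_scrambled X f \<delta> S \<longleftrightarrow>
     S \<subseteq> X \<and> (\<exists>x\<in>S. \<exists>y\<in>S. x \<noteq> y) \<and>
     (\<forall>x\<in>S. \<forall>y\<in>S. x \<noteq> y \<longrightarrow>
        liminf (\<lambda>n. ereal (dist (time_map f n x) (time_map f n y))) = 0 \<and>
        limsup (\<lambda>n. ereal (dist (time_map f n x) (time_map f n y))) > ereal \<delta>)"

definition Li_Yorke_chaotic ::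
  "'a::metric_space set \<Rightarrow> (nat \<Rightarrow> 'a \<Rightarrow> 'a) \<Rightarrow> real \<Rightarrow> bool" where
  "Li_Yorke_chaotic X f \<delta> \<longleftrightarrow> (\<exists>S. uncountable S \<and> Li_Yorke_scrambled X f \<delta> S)"

end

theory Submission
  imports Defs
begin

text \<open>From distributional chaos to Li-Yorke chaos: if a pair were eventually at distance at least
  \<open>\<epsilon>\<close>, then the averages of its closeness indicators along any increasing sequence would
  tend to \<open>0\<close>, and if it were eventually at distance less than \<open>\<delta>\<close>, they would tend to \<open>1\<close>. So upper
  distribution \<open>1\<close> forces arbitrarily close returns and lower distribution \<open>0\<close> at \<open>\<delta>\<close> forces
  infinitely many separations by at least \<open>\<delta>\<close>; the same set is Li-Yorke scrambled for
  every smaller constant.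

  From Li-Yorke chaos to distributional chaos: the given scrambled set \<open>S\<close> need not be scrambled
  distributionally along any one sequence, since each pair has its own times of proximity and
  separation. But a single sequence can be made to serve countably many pairs. Compactness gives a
  countable nonempty \<open>D \<subseteq> S\<close> without isolated points
  (\<open>countable_dense_in_itself_subset\<close>). Enumerate all tasks ``bring \<open>a\<close> and \<open>b\<close> together'' and
  ``separate \<open>a\<close> and \<open>b\<close>'' for distinct \<open>a, b \<in> D\<close> so that each task recurs infinitely often. Divide the
  index set of the sequence into the blocks \<open>{j!..<(j+1)!}\<close>, and choose the terms
  in the \<open>j\<close>-th block among the infinitely many times at which the \<open>j\<close>-th task is achieved. A block
  fills all but a fraction \<open>1/(j+1)\<close> of the indices up to its end, so any pair of points for which infinitely
  many whole blocks are close blocks and infinitely many are separation blocks has the required upper and lower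
  distributions (\<open>distributions_of_factorial_blocks\<close>).

  Succeeding on a block is an open condition on a pair, because a block is finite. Hence the good
  pairs contain a \<open>G\<^sub>\<delta>\<close> subset of \<open>K \<times> K\<close>, where \<open>K\<close> is the closure of \<open>D\<close>, and this subset contains all
  pairs of distinct points of \<open>D\<close>, so it is dense. A category argument in the manner of Kuratowski and Ulam,
  followed by Zorn's lemma, then extracts an uncountable scrambled set from \<open>K\<close>
  (\<open>uncountable_scrambled_set_of_open_relations\<close>).\<close>

section \<open>Limits of averages\<close>

lemma averages_of_eventually_constant:
  fixes u :: "nat \<Rightarrow> real"
  assumes "eventually (\<lambda>i. u i = c) sequentially"
  shows "(\<lambda>n. 1 / real n * (\<Sum>i<n. u i)) \<longlonglongrightarrow> c"
proof -
  obtain N where N: "\<And>i. i \<ge> N \<Longrightarrow> u i = c"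
    using assms by (auto simp: eventually_sequentially)
  define A where "A = (\<Sum>i<N. u i) - real N * c"
  have avg: "1 / real n * (\<Sum>i<n. u i) = A * inverse (real n) + c" if "n > N" for n
  proof -
    have "{..<n} = {..<N} \<union> {N..<n}" using that by auto
    then have "(\<Sum>i<n. u i) = (\<Sum>i<N. u i) + (\<Sum>i\<in>{N..<n}. u i)"
      by (simp add: sum.union_disjoint ivl_disj_int)
    also have "(\<Sum>i\<in>{N..<n}. u i) = (real n - real N) * c"
      using that by (simp add: N of_nat_diff)
    finally show ?thesis using that by (simp add: A_def field_simps)
  qed
  have "(\<lambda>n. A * inverse (real n) + c) \<longlonglongrightarrow> A * 0 + c"
    by (intro tendsto_intros lim_inverse_n)
  moreover have "eventually (\<lambda>n. A * inverse (real n) + c = 1 / real n * (\<Sum>i<n. u i)) sequentially"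
    using eventually_gt_at_top[of N] by eventually_elim (rule avg[symmetric])
  ultimately show ?thesis
    by (simp add: Lim_transform_eventually)
qed

lemma closeness_average_bounds:
  "0 \<le> closeness_average f p x y \<epsilon> n" "closeness_average f p x y \<epsilon> n \<le> 1"
proof -
  let ?u = "\<lambda>i. indicator {0..<\<epsilon>} (dist (time_map f (p i) x) (time_map f (p i) y)) :: real"
  have "(\<Sum>i<n. ?u i) \<le> (\<Sum>i<n. 1)" by (rule sum_mono) (simp add: indicator_def)
  then show "closeness_average f p x y \<epsilon> n \<le> 1"
    by (cases "n = 0") (simp_all add: closeness_average_def)
  have "(\<Sum>i<n. ?u i) \<ge> 0" by (rule sum_nonneg) (simp add: indicator_def)
  then show "0 \<le> closeness_average f p x y \<epsilon> n"
    by (simp add: closeness_average_def)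
qed

lemma frequently_close_of_upper_distribution:
  assumes "strict_mono p" "upper_distribution f p x y \<epsilon> = 1"
  shows "\<exists>\<^sub>F n in sequentially. dist (time_map f n x) (time_map f n y) < \<epsilon>"
proof (rule ccontr)
  let ?u = "\<lambda>i. indicator {0..<\<epsilon>} (dist (time_map f (p i) x) (time_map f (p i) y)) :: real"
  assume "\<not> ?thesis"
  then have "eventually (\<lambda>n. \<not> dist (time_map f n x) (time_map f n y) < \<epsilon>) sequentially"
    by (simp add: not_frequently)
  then have "eventually (\<lambda>i. ?u i = 0) sequentially"
    by (rule eventually_mono[OF eventually_compose_filterlim[OF _ filterlim_subseq[OF assms(1)]]]) auto
  then have "closeness_average f p x y \<epsilon> \<longlonglongrightarrow> 0"
    unfolding closeness_average_def by (rule averages_of_eventually_constant)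
  then have "(\<lambda>n. ereal (closeness_average f p x y \<epsilon> n)) \<longlonglongrightarrow> ereal 0"
    by simp
  then have "upper_distribution f p x y \<epsilon> = 0"
    unfolding upper_distribution_def by (simp add: lim_imp_Limsup zero_ereal_def)
  with assms(2) show False by simp
qed

lemma frequently_separated_of_lower_distribution:
  assumes "strict_mono p" "lower_distribution f p x y \<delta> = 0"
  shows "\<exists>\<^sub>F n in sequentially. dist (time_map f n x) (time_map f n y) \<ge> \<delta>"
proof (rule ccontr)
  let ?u = "\<lambda>i. indicator {0..<\<delta>} (dist (time_map f (p i) x) (time_map f (p i) y)) :: real"
  assume "\<not> ?thesis"
  then have "eventually (\<lambda>n. \<not> dist (time_map f n x) (time_map f n y) \<ge> \<delta>) sequentially"
    by (simp add: not_frequently)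
  then have "eventually (\<lambda>i. ?u i = 1) sequentially"
    by (rule eventually_mono[OF eventually_compose_filterlim[OF _ filterlim_subseq[OF assms(1)]]]) auto
  then have "closeness_average f p x y \<delta> \<longlonglongrightarrow> 1"
    unfolding closeness_average_def by (rule averages_of_eventually_constant)
  then have "(\<lambda>n. ereal (closeness_average f p x y \<delta> n)) \<longlonglongrightarrow> ereal 1"
    by simp
  then have "lower_distribution f p x y \<delta> = 1"
    unfolding lower_distribution_def by (simp add: lim_imp_Liminf one_ereal_def)
  with assms(2) show False by simp
qed

section \<open>Extreme values of lower and upper limits\<close>

lemma liminf_eq_0_iff_frequently_small:
  fixes v :: "nat \<Rightarrow> real"
  assumes "\<And>n. 0 \<le> v n"
  shows "liminf (\<lambda>n. ereal (v n)) = 0 \<longleftrightarrow> (\<forall>\<epsilon>>0. \<exists>\<^sub>F n in sequentially. v n < \<epsilon>)"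
proof
  assume lim: "liminf (\<lambda>n. ereal (v n)) = 0"
  show "\<forall>\<epsilon>>0. \<exists>\<^sub>F n in sequentially. v n < \<epsilon>"
  proof (intro allI impI, rule ccontr)
    fix \<epsilon> :: real assume "0 < \<epsilon>" "\<not> (\<exists>\<^sub>F n in sequentially. v n < \<epsilon>)"
    then have "eventually (\<lambda>n. ereal \<epsilon> \<le> ereal (v n)) sequentially"
      by (simp add: not_frequently not_less)
    then have "ereal \<epsilon> \<le> liminf (\<lambda>n. ereal (v n))"
      by (rule Liminf_bounded)
    with lim \<open>0 < \<epsilon>\<close> show False by simp
  qed
next
  assume small: "\<forall>\<epsilon>>0. \<exists>\<^sub>F n in sequentially. v n < \<epsilon>"
  have ge: "0 \<le> liminf (\<lambda>n. ereal (v n))"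
    by (rule Liminf_bounded) (simp add: assms)
  moreover have "\<not> 0 < liminf (\<lambda>n. ereal (v n))"
  proof
    assume "0 < liminf (\<lambda>n. ereal (v n))"
    then obtain r where r: "0 < ereal r" "ereal r < liminf (\<lambda>n. ereal (v n))"
      using ereal_dense2 by blast
    from less_LiminfD[OF r(2)] have "eventually (\<lambda>n. \<not> v n < r) sequentially"
      by eventually_elim simp
    with small r(1) show False by (auto simp: frequently_def)
  qed
  ultimately show "liminf (\<lambda>n. ereal (v n)) = 0" by order
qed

lemma limsup_eq_1_iff_frequently_near_1:
  fixes v :: "nat \<Rightarrow> real"
  assumes "\<And>n. v n \<le> 1"
  shows "limsup (\<lambda>n. ereal (v n)) = 1 \<longleftrightarrow> (\<forall>\<epsilon>>0. \<exists>\<^sub>F n in sequentially. 1 - v n < \<epsilon>)"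
proof -
  have "liminf (\<lambda>n. ereal (1 - v n)) = liminf (\<lambda>n. 1 - ereal (v n))"
    by (simp add: one_ereal_def)
  also have "\<dots> = 1 - limsup (\<lambda>n. ereal (v n))"
    by (rule liminf_ereal_cminus) simp
  finally have "limsup (\<lambda>n. ereal (v n)) = 1 \<longleftrightarrow> liminf (\<lambda>n. ereal (1 - v n)) = 0"
    by (cases "limsup (\<lambda>n. ereal (v n))") (auto simp: one_ereal_def zero_ereal_def)
  then show ?thesis
    using liminf_eq_0_iff_frequently_small[of "\<lambda>n. 1 - v n"] assms by simp
qed

lemma limsup_greater_imp_frequently:
  assumes "ereal \<delta> < limsup (\<lambda>n. ereal (v n))"
  shows "\<exists>\<^sub>F n in sequentially. \<delta> < v n"
proof (rule ccontr)
  assume "\<not> ?thesis"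
  then have "eventually (\<lambda>n. ereal (v n) \<le> ereal \<delta>) sequentially"
    by (simp add: not_frequently not_less)
  then have "limsup (\<lambda>n. ereal (v n)) \<le> ereal \<delta>" by (rule Limsup_bounded)
  with assms show False by simp
qed

section \<open>Distributional chaos implies Li-Yorke chaos\<close>

text \<open>The loss from \<open>\<delta>\<close> to \<open>\<eta>\<close> comes from the strict inequality in the Li-Yorke condition:
  separations by at least \<open>\<delta>\<close> only show that the upper limit is at least \<open>\<delta>\<close>.\<close>

lemma Li_Yorke_chaotic_of_distributionally_chaotic:
  assumes "strict_mono q" "distributionally_chaotic X f \<delta> q" "\<eta> < \<delta>"
  shows "Li_Yorke_chaotic X f \<eta>"
proof -
  obtain D where D: "uncountable D" "distributionally_scrambled X f \<delta> q D"
    using assms(2) unfolding distributionally_chaotic_def by blast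
  have "liminf (\<lambda>n. ereal (dist (time_map f n x) (time_map f n y))) = 0 \<and>
        limsup (\<lambda>n. ereal (dist (time_map f n x) (time_map f n y))) > ereal \<eta>"
    if xy: "x \<in> D" "y \<in> D" "x \<noteq> y" for x y
  proof
    have up: "\<forall>\<epsilon>>0. upper_distribution f q x y \<epsilon> = 1" and low: "lower_distribution f q x y \<delta> = 0"
      using D(2) xy unfolding distributionally_scrambled_def by blast+
    show "liminf (\<lambda>n. ereal (dist (time_map f n x) (time_map f n y))) = 0"
      using frequently_close_of_upper_distribution[OF assms(1)] up
      by (subst liminf_eq_0_iff_frequently_small) (simp, blast)
    show "limsup (\<lambda>n. ereal (dist (time_map f n x) (time_map f n y))) > ereal \<eta>"
    proof (rule ccontr)
      assume "\<not> ?thesis"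
      then have "limsup (\<lambda>n. ereal (dist (time_map f n x) (time_map f n y))) < ereal \<delta>"
        using assms(3) by (meson leI less_ereal.simps(1) order.strict_trans1)
      from Limsup_lessD[OF this]
      have "eventually (\<lambda>n. \<not> \<delta> \<le> dist (time_map f n x) (time_map f n y)) sequentially"
        by eventually_elim simp
      with frequently_separated_of_lower_distribution[OF assms(1) low] show False
        by (simp add: frequently_def)
    qed
  qed
  then have "Li_Yorke_scrambled X f \<eta> D"
    using D(2) unfolding Li_Yorke_scrambled_def distributionally_scrambled_def by blast
  with D(1) show ?thesis unfolding Li_Yorke_chaotic_def by blast
qed

section \<open>Uncountable scrambled sets from Baire category\<close>

text \<open>A Mycielski-type theorem for a countable family of open relations. Call a point generic if all
  its sections are dense. The points of \<open>D\<close> are generic, and genericity is a countable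
  intersection of open conditions, so generic points form a dense \<open>G\<^sub>\<delta>\<close>. Given countably many generic
  points, the Baire category theorem yields a generic point in all their sections; it is
  new by irreflexivity. So a maximal scrambled set of generic points, which exists by Zorn's lemma,
  cannot be countable. Requiring irreflexivity of only one relation, possibly depending on the
  point, allows proximity to be among the relations.\<close>

lemma uncountable_scrambled_set_of_open_relations:
  fixes K :: "'a::metric_space set" and R :: "'i::countable \<Rightarrow> 'a \<Rightarrow> 'a \<Rightarrow> bool"
  assumes "compact K" "K \<noteq> {}"
    and D: "countable D" "D \<subseteq> K" "K \<subseteq> closure D"
    and sym: "\<And>i x y. R i x y \<Longrightarrow> R i y x"
    and irrefl: "\<And>x. \<exists>i. \<not> R i x x"
    and opn: "\<And>i x. x \<in> K \<Longrightarrow> openin (top_of_set K) {y \<in> K. R i x y}"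
    and dns: "\<And>i d. d \<in> D \<Longrightarrow> K \<subseteq> closure {y \<in> K. R i d y}"
  shows "\<exists>C\<subseteq>K. uncountable C \<and> (\<forall>x\<in>C. \<forall>y\<in>C. x \<noteq> y \<longrightarrow> (\<forall>i. R i x y))"
proof -
  have ball_dns: "\<exists>y\<in>K. R i d y \<and> dist y z < e" if "d \<in> D" "z \<in> K" "e > 0" for i d z e
    using dns[OF that(1), of i] that(2,3) by (auto simp: subset_iff closure_approachable)
  \<comment> \<open>Balls centred in \<open>D\<close> with radii \<open>1/(n+1)\<close> form a countable base of \<open>K\<close>, so the set \<open>E\<close> below
    consists of the points all of whose sections are dense.\<close>
  define V where "V i a n = {x \<in> K. \<exists>y\<in>K \<inter> ball a (inverse (real (Suc n))). R i x y}" for i a n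
  define E where "E = (\<Inter>i. \<Inter>a\<in>D. \<Inter>n. V i a n)"
  have V_open: "openin (top_of_set K) (V i a n)" for i a n
  proof -
    have "V i a n = (\<Union>y\<in>K \<inter> ball a (inverse (real (Suc n))). {x \<in> K. R i y x})"
      unfolding V_def using sym by blast
    then show ?thesis using opn by auto
  qed
  have V_dense: "D \<subseteq> V i a n" if "a \<in> D" for i a n
  proof
    fix d assume "d \<in> D"
    then show "d \<in> V i a n"
      using ball_dns[of d a "inverse (real (Suc n))" i] that D(2)
      by (fastforce simp: V_def dist_commute)
  qed
  have E_dense: "K \<subseteq> closure {y \<in> K. R i c y}" if "c \<in> E" "c \<in> K" for c i
  proof
    fix z assume "z \<in> K"
    show "z \<in> closure {y \<in> K. R i c y}"
    proof (subst closure_approachable, intro allI impI)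
      fix e :: real assume "e > 0"
      then obtain n where n: "inverse (real (Suc n)) < e / 2"
        using reals_Archimedean[of "e / 2"] by auto
      obtain a where a: "a \<in> D" "dist a z < inverse (real (Suc n))"
        using D(3) \<open>z \<in> K\<close> by (metis closure_approachable inverse_positive_iff_positive of_nat_0_less_iff subsetD zero_less_Suc)
      from that a(1) obtain y where y: "y \<in> K" "dist a y < inverse (real (Suc n))" "R i c y"
        unfolding E_def V_def by fastforce
      have "dist y z < e"
        using dist_triangle[of y z a] a(2) y(2) n by (simp add: dist_commute)
      with y show "\<exists>y\<in>{y \<in> K. R i c y}. dist y z < e" by blast
    qed
  qed
  have extend: "\<exists>x\<in>E \<inter> K. \<forall>c\<in>C. \<forall>i. R i c x" if C: "C \<subseteq> E \<inter> K" "countable C" for C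
  proof -
    let ?G = "(\<lambda>(i, a, n). V i a n) ` (UNIV \<times> D \<times> UNIV) \<union> (\<lambda>(i, c). {y \<in> K. R i c y}) ` (UNIV \<times> C)"
    have "top_of_set K closure_of \<Inter>?G = topspace (top_of_set K)"
    proof (rule Baire_category)
      have "compact_space (top_of_set K)"
        using assms(1) by (simp add: compact_space_subtopology)
      moreover have "Hausdorff_space (top_of_set K)"
        by (simp add: Hausdorff_space_subtopology)
      ultimately show "completely_metrizable_space (top_of_set K) \<or>
          locally_compact_space (top_of_set K) \<and> regular_space (top_of_set K)"
        by (simp add: compact_Hausdorff_imp_regular_space compact_imp_locally_compact_space)
      show "countable ?G" using D(1) C(2) by auto
      fix T assume "T \<in> ?G"
      then have "openin (top_of_set K) T \<and> K \<subseteq> closure T"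
      proof
        assume "T \<in> (\<lambda>(i, a, n). V i a n) ` (UNIV \<times> D \<times> UNIV)"
        then obtain i a n where "a \<in> D" "T = V i a n" by auto
        then show ?thesis
          using V_open V_dense[of a i n] D(3) closure_mono by blast
      next
        assume "T \<in> (\<lambda>(i, c). {y \<in> K. R i c y}) ` (UNIV \<times> C)"
        then obtain i c where "c \<in> C" "T = {y \<in> K. R i c y}" by auto
        then show ?thesis using C(1) opn E_dense by blast
      qed
      then show "openin (top_of_set K) T \<and>
          top_of_set K closure_of T = topspace (top_of_set K)"
        by (auto simp: closure_of_subtopology dest!: openin_imp_subset simp: inf_absorb2)
    qed
    then have "top_of_set K closure_of (K \<inter> \<Inter>?G) = K"
      using closure_of_restrict[of "top_of_set K" "\<Inter>?G"] by simp
    with \<open>K \<noteq> {}\<close> have "K \<inter> \<Inter>?G \<noteq> {}"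
      using closure_of_empty[of "top_of_set K"] by force
    then obtain x where x: "x \<in> K" "x \<in> \<Inter>?G" unfolding ex_in_conv[symmetric] by (elim exE IntE)
    have "x \<in> V i a n" if "a \<in> D" for i a n
      by (rule InterD[OF x(2) UnI1[OF image_eqI[of _ _ "(i, a, n)"]]]) (use that in simp_all)
    moreover have "x \<in> {y \<in> K. R i c y}" if "c \<in> C" for i c
      by (rule InterD[OF x(2) UnI2[OF image_eqI[of _ _ "(i, c)"]]]) (use that in simp_all)
    ultimately show ?thesis using x(1) unfolding E_def by blast
  qed
  let ?\<A> = "{C. C \<subseteq> E \<inter> K \<and> (\<forall>x\<in>C. \<forall>y\<in>C. x \<noteq> y \<longrightarrow> (\<forall>i. R i x y))}"
  have "\<exists>M\<in>?\<A>. \<forall>C\<in>?\<A>. M \<subseteq> C \<longrightarrow> C = M"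
  proof (rule subset_Zorn')
    fix \<C> assume ch: "subset.chain ?\<A> \<C>"
    then have sub: "\<C> \<subseteq> ?\<A>" and nested: "\<And>A B. A \<in> \<C> \<Longrightarrow> B \<in> \<C> \<Longrightarrow> A \<subseteq> B \<or> B \<subseteq> A"
      by (simp_all only: subset_chain_def)
    have "R i x y" if xy: "x \<in> \<Union>\<C>" "y \<in> \<Union>\<C>" "x \<noteq> y" for x y i
    proof -
      obtain A B where A: "A \<in> \<C>" "x \<in> A" and B: "B \<in> \<C>" "y \<in> B" using xy(1,2) by (elim UnionE)
      have "\<exists>A\<in>\<C>. x \<in> A \<and> y \<in> A"
        using nested[OF A(1) B(1)] A B by (elim disjE) (meson subsetD)+
      then obtain A where A: "A \<in> \<C>" "x \<in> A" "y \<in> A" by (elim bexE conjE)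
      from subsetD[OF sub A(1)] show ?thesis using A(2,3) xy(3) by simp
    qed
    moreover have "\<Union>\<C> \<subseteq> E \<inter> K" 
    proof (rule Union_least)
      fix A assume "A \<in> \<C>"
      from subsetD[OF sub this] show "A \<subseteq> E \<inter> K" by simp
    qed
    ultimately show "\<Union>\<C> \<in> ?\<A>" by simp
  qed
  then obtain M where "M \<in> ?\<A>" and max: "\<forall>C\<in>?\<A>. M \<subseteq> C \<longrightarrow> C = M" by (elim bexE)
  then have M: "M \<subseteq> E \<inter> K" and M_R: "\<forall>x\<in>M. \<forall>y\<in>M. x \<noteq> y \<longrightarrow> (\<forall>i. R i x y)" by simp_all
  have "uncountable M"
  proof
    assume "countable M"
    from extend[OF M this] obtain x where x: "x \<in> E" "x \<in> K" "\<forall>c\<in>M. \<forall>i. R i c x" by blast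
    then have "x \<notin> M" using irrefl[of x] by blast
    moreover have "insert x M \<in> ?\<A>" using M M_R x sym by simp
    ultimately have "insert x M = M" using max by (simp add: subset_insertI)
    with \<open>x \<notin> M\<close> show False by blast
  qed
  with M M_R show ?thesis by (intro exI[of _ M]) simp
qed

text \<open>A compact set has a countable base of balls. Removing from \<open>S\<close> every basic ball that meets it in a countable
  set leaves a set \<open>S'\<close> that meets each basic ball in no point or in uncountably many points. Two points
  of \<open>S'\<close> from each ball of the second kind make up \<open>D\<close>; taking two ensures that around each point
  of \<open>D\<close> there is always another one.\<close>

lemma countable_dense_in_itself_subset:
  fixes S :: "'a::metric_space set"
  assumes "compact X" "S \<subseteq> X" "uncountable S"
  shows "\<exists>D\<subseteq>S. countable D \<and> D \<noteq> {} \<and> (\<forall>d\<in>D. d islimpt D)"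
proof -
  have "\<forall>n. \<exists>Z. finite Z \<and> X \<subseteq> (\<Union>z\<in>Z. ball z (inverse (real (Suc n))))"
    using compact_imp_seq_compact[OF assms(1)] seq_compact_imp_totally_bounded
    by (metis inverse_positive_iff_positive of_nat_0_less_iff zero_less_Suc)
  then obtain Z where Z: "\<And>n. finite (Z n)" "\<And>n. X \<subseteq> (\<Union>z\<in>Z n. ball z (inverse (real (Suc n))))"
    by metis
  define \<B> where "\<B> = (\<Union>n. (\<lambda>z. ball z (inverse (real (Suc n)))) ` Z n)"
  have "countable \<B>"
    unfolding \<B>_def using Z(1) by (intro countable_UN countable_image) (auto simp: countable_finite)
  have small: "\<exists>B\<in>\<B>. x \<in> B \<and> B \<subseteq> ball x e" if "x \<in> X" "e > 0" for x e
  proof -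
    obtain n where n: "inverse (real (Suc n)) < e / 2"
      using reals_Archimedean[of "e / 2"] \<open>e > 0\<close> by auto
    obtain z where z: "z \<in> Z n" "x \<in> ball z (inverse (real (Suc n)))" using Z(2)[of n] \<open>x \<in> X\<close> by blast
    have "ball z (inverse (real (Suc n))) \<subseteq> ball x e"
    proof
      fix w assume "w \<in> ball z (inverse (real (Suc n)))"
      then show "w \<in> ball x e"
        using dist_triangle[of x w z] z(2) n by (simp add: dist_commute)
    qed
    with z show ?thesis unfolding \<B>_def by blast
  qed
  define N where "N = (\<Union>B\<in>{B \<in> \<B>. countable (B \<inter> S)}. B \<inter> S)"
  define S' where "S' = S - N"
  have cnt: "countable N"
    unfolding N_def using \<open>countable \<B>\<close> by (intro countable_UN) (auto intro: countable_subset)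
  have "uncountable (B \<inter> S')" if "B \<in> \<B>" "B \<inter> S' \<noteq> {}" for B
  proof -
    have "uncountable (B \<inter> S)" using that unfolding S'_def N_def by blast
    moreover have "B \<inter> S' = B \<inter> S - N"
      unfolding S'_def by blast
    ultimately show ?thesis using uncountable_minus_countable[OF _ cnt] by metis
  qed
  then have "\<exists>a b. a \<noteq> b \<and> a \<in> B \<inter> S' \<and> b \<in> B \<inter> S'" if "B \<in> \<B>" "B \<inter> S' \<noteq> {}" for B
    using that by (metis countable_empty countable_insert subset_singletonD subsetI insertCI singletonI countable_subset)
  then obtain a b where ab: "\<And>B. B \<in> \<B> \<Longrightarrow> B \<inter> S' \<noteq> {} \<Longrightarrow> a B \<noteq> b B \<and> a B \<in> B \<inter> S' \<and> b B \<in> B \<inter> S'"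
    by metis
  define D where "D = (\<Union>B\<in>{B \<in> \<B>. B \<inter> S' \<noteq> {}}. {a B, b B})"
  have D_S': "D \<subseteq> S'" using ab unfolding D_def by blast
  have "countable D" unfolding D_def using \<open>countable \<B>\<close> by (intro countable_UN) auto
  moreover have "D \<noteq> {}"
  proof -
    have "uncountable S'" unfolding S'_def using assms(3) cnt by (rule uncountable_minus_countable)
    then obtain s where "s \<in> S'" by (metis countable_empty ex_in_conv)
    then have "s \<in> X" using assms(2) S'_def by blast
    from small[OF this, of 1] obtain B where "B \<in> \<B>" "s \<in> B" by auto
    with \<open>s \<in> S'\<close> show ?thesis unfolding D_def by blast
  qed
  moreover have "d islimpt D" if "d \<in> D" for d
    unfolding islimpt_approachable
  proof (intro allI impI)
    fix e :: real assume "e > 0"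
    have "d \<in> S'" "d \<in> X" using that D_S' S'_def assms(2) by auto
    from small[OF this(2) \<open>e > 0\<close>] obtain B where B: "B \<in> \<B>" "d \<in> B" "B \<subseteq> ball d e" by blast
    with \<open>d \<in> S'\<close> have ne: "B \<inter> S' \<noteq> {}" by blast
    then have "a B \<in> D" "b B \<in> D" using B(1) unfolding D_def by auto
    moreover have "dist (a B) d < e" "dist (b B) d < e" "a B \<noteq> b B"
      using ab[OF B(1) ne] B(3) by (auto simp: dist_commute)
    ultimately show "\<exists>x'\<in>D. x' \<noteq> d \<and> dist x' d < e" by metis
  qed
  moreover have "D \<subseteq> S" using D_S' unfolding S'_def by blast
  ultimately show ?thesis by (intro exI[of _ D]) simp
qed

section \<open>A sequence of times serving countably many pairs\<close>

lemma continuous_on_time_map: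
  assumes "\<And>n. f n ` X \<subseteq> X" "\<And>n. continuous_on X (f n)"
  shows "continuous_on X (time_map f n)"
proof -
  have "continuous_on X (time_map f n) \<and> time_map f n ` X \<subseteq> X"
  proof (induction n)
    case (Suc n)
    then have "continuous_on (time_map f n ` X) (f n)"
      using assms(2) continuous_on_subset by blast
    then have "continuous_on X (time_map f (Suc n))"
      using Suc unfolding time_map.simps(2) by (blast intro: continuous_on_compose)
    moreover have "time_map f (Suc n) ` X \<subseteq> X"
      using Suc assms(1)[of n] by (simp add: image_comp[symmetric]) blast
    ultimately show ?case by blast
  qed simp
  then show ?thesis by blast
qed

lemma enumeration_infinitely_often:
  assumes "countable A" "A \<noteq> {}"
  shows "\<exists>e :: nat \<Rightarrow> 'b. range e \<subseteq> A \<and> (\<forall>a\<in>A. \<exists>\<^sub>F n in sequentially. e n = a)"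
proof (intro exI conjI ballI)
  let ?e = "\<lambda>n. from_nat_into A (fst (prod_decode n))"
  show "range ?e \<subseteq> A" using from_nat_into[OF assms(2)] by blast
  fix a assume "a \<in> A"
  then obtain k where k: "from_nat_into A k = a" using from_nat_into_surj[OF assms(1)] by blast
  show "\<exists>\<^sub>F n in sequentially. ?e n = a"
    unfolding frequently_sequentially
  proof
    fix N
    show "\<exists>n\<ge>N. ?e n = a"
      using k by (intro exI[of _ "prod_encode (k, N)"]) (simp add: le_prod_encode_2)
  qed
qed

lemma strict_mono_selection:
  fixes T :: "nat \<Rightarrow> nat set"
  assumes "\<And>i. infinite (T i)"
  shows "\<exists>p. strict_mono p \<and> (\<forall>i. p i \<in> T i)"
proof -
  have "\<exists>p. \<forall>i. p i \<in> T i \<and> p i < p (Suc i)"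
  proof (rule dependent_nat_choice)
    show "\<exists>t. t \<in> T 0" using assms[of 0] by (metis ex_in_conv finite.emptyI)
    show "\<exists>s. s \<in> T (Suc i) \<and> t < s" for t i
      using assms[of "Suc i"] unfolding infinite_nat_iff_unbounded by blast
  qed
  then show ?thesis by (metis strict_mono_Suc_iff)
qed

text \<open>The indices below \<open>m\<close>, whatever happens there, change an average of length \<open>n\<close> by at most
  \<open>m / n\<close>.\<close>

lemma closeness_average_block:
  assumes "m \<le> n" "0 < n"
  shows "(\<And>i. m \<le> i \<Longrightarrow> i < n \<Longrightarrow> dist (time_map f (p i) x) (time_map f (p i) y) < \<epsilon>) \<Longrightarrow>
           1 - closeness_average f p x y \<epsilon> n \<le> real m / real n"
    and "(\<And>i. m \<le> i \<Longrightarrow> i < n \<Longrightarrow> \<epsilon> \<le> dist (time_map f (p i) x) (time_map f (p i) y)) \<Longrightarrow>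
           closeness_average f p x y \<epsilon> n \<le> real m / real n"
proof -
  let ?u = "\<lambda>i. indicator {0..<\<epsilon>} (dist (time_map f (p i) x) (time_map f (p i) y)) :: real"
  have "{..<n} = {..<m} \<union> {m..<n}" using assms by auto
  then have split: "(\<Sum>i<n. ?u i) = (\<Sum>i<m. ?u i) + (\<Sum>i\<in>{m..<n}. ?u i)"
    by (simp add: sum.union_disjoint ivl_disj_int)
  have low: "(\<Sum>i<m. ?u i) \<ge> 0" by (rule sum_nonneg) (simp add: indicator_def)
  have "(\<Sum>i<m. ?u i) \<le> (\<Sum>i<m. 1)" by (rule sum_mono) (simp add: indicator_def)
  then have high: "(\<Sum>i<m. ?u i) \<le> real m" by simp
  show "1 - closeness_average f p x y \<epsilon> n \<le> real m / real n"
    if close: "\<And>i. m \<le> i \<Longrightarrow> i < n \<Longrightarrow> dist (time_map f (p i) x) (time_map f (p i) y) < \<epsilon>"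
  proof -
    have "(\<Sum>i\<in>{m..<n}. ?u i) = (\<Sum>i\<in>{m..<n}. 1)" using close by (intro sum.cong) auto
    then have "(\<Sum>i<n. ?u i) \<ge> real n - real m"
      using split low assms by (simp add: of_nat_diff)
    then have "(real n - (\<Sum>i<n. ?u i)) / real n \<le> real m / real n"
      by (intro divide_right_mono) auto
    then show ?thesis using assms by (simp add: closeness_average_def diff_divide_distrib)
  qed
  show "closeness_average f p x y \<epsilon> n \<le> real m / real n"
    if far: "\<And>i. m \<le> i \<Longrightarrow> i < n \<Longrightarrow> \<epsilon> \<le> dist (time_map f (p i) x) (time_map f (p i) y)"
  proof -
    have "(\<Sum>i\<in>{m..<n}. ?u i) = 0" using far by (intro sum.neutral) (auto simp: indicator_def not_less)
    then have "(\<Sum>i<n. ?u i) \<le> real m" using split high by simp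
    then show ?thesis using assms by (simp add: closeness_average_def divide_right_mono)
  qed
qed

text \<open>Block lengths grow fast enough that each block outweighs everything before it: \<open>j! / (j+1)!\<close>
  tends to \<open>0\<close>. The block for \<open>j = 0\<close> is empty.\<close>

definition factorial_block :: "nat \<Rightarrow> nat set" where
  "factorial_block j = {fact j..<fact (Suc j)}"

text \<open>The closeness bound \<open>1/(j+1)\<close> shrinks along the blocks, so that one family of close blocks
  serves every \<open>\<epsilon>\<close>.\<close>

lemma distributions_of_factorial_blocks:
  assumes close: "\<And>m. \<exists>j\<ge>m. \<forall>i\<in>factorial_block j.
              dist (time_map f (p i) x) (time_map f (p i) y) < inverse (real (Suc j))"
    and far: "\<And>m. \<exists>j\<ge>m. \<forall>i\<in>factorial_block j.
              \<delta> \<le> dist (time_map f (p i) x) (time_map f (p i) y)"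
  shows "\<epsilon> > 0 \<Longrightarrow> upper_distribution f p x y \<epsilon> = 1" "lower_distribution f p x y \<delta> = 0"
proof -
  have ratio: "real (fact j) / real (fact (Suc j)) = inverse (real (Suc j))" for j
  proof -
    have "real (fact (Suc j)) = real (Suc j) * real (fact j)"
      by (simp only: fact_Suc of_nat_mult of_nat_id)
    then show ?thesis by (simp add: inverse_eq_divide del: fact_Suc of_nat_Suc)
  qed
  have le: "(fact j :: nat) \<le> fact (Suc j)" "(0 :: nat) < fact (Suc j)" for j
    by (auto simp: fact_mono_nat simp del: fact_Suc)
  have mono: "inverse (real (Suc j)) \<le> inverse (real (Suc m))" if "m \<le> j" for m j
    using that by (simp add: divide_simps)
  have large: "\<exists>m\<ge>N. inverse (real (Suc m)) < \<eta>" if "\<eta> > 0" for N and \<eta> :: real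
  proof -
    obtain n where "inverse (real (Suc n)) < \<eta>" using reals_Archimedean[OF \<open>\<eta> > 0\<close>] by blast
    then show ?thesis using mono[of n "max n N"] by (intro exI[of _ "max n N"]) linarith
  qed
  have index: "N \<le> fact (Suc j)" if "N \<le> j" for N j :: nat
    using that fact_ge_self[of "Suc j"] by linarith
  show "upper_distribution f p x y \<epsilon> = 1" if "\<epsilon> > 0"
    unfolding upper_distribution_def limsup_eq_1_iff_frequently_near_1[OF closeness_average_bounds(2)]
      frequently_sequentially
  proof (intro allI impI)
    fix \<eta> :: real and N :: nat assume "\<eta> > 0"
    with that obtain m where m: "m \<ge> N" "inverse (real (Suc m)) < min \<epsilon> \<eta>"
      using large[of "min \<epsilon> \<eta>" N] by auto
    obtain j where j: "j \<ge> m" "\<forall>i\<in>factorial_block j.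
        dist (time_map f (p i) x) (time_map f (p i) y) < inverse (real (Suc j))"
      using close by blast
    have "1 - closeness_average f p x y \<epsilon> (fact (Suc j)) \<le> inverse (real (Suc j))"
      unfolding ratio[symmetric]
    proof (rule closeness_average_block(1)[OF le])
      fix i :: nat assume "fact j \<le> i" "i < fact (Suc j)"
      then have "dist (time_map f (p i) x) (time_map f (p i) y) < inverse (real (Suc j))"
        using j(2) by (simp add: factorial_block_def del: fact_Suc)
      with m(2) mono[OF j(1)] show "dist (time_map f (p i) x) (time_map f (p i) y) < \<epsilon>" by linarith
    qed
    then have "1 - closeness_average f p x y \<epsilon> (fact (Suc j)) < \<eta>"
      using m(2) mono[OF j(1)] by linarith
    moreover have "N \<le> fact (Suc j)" using index[of N j] m(1) j(1) by linarith
    ultimately show "\<exists>n\<ge>N. 1 - closeness_average f p x y \<epsilon> n < \<eta>" by blast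
  qed
  show "lower_distribution f p x y \<delta> = 0"
    unfolding lower_distribution_def liminf_eq_0_iff_frequently_small[OF closeness_average_bounds(1)]
      frequently_sequentially
  proof (intro allI impI)
    fix \<eta> :: real and N :: nat assume "\<eta> > 0"
    then obtain m where m: "m \<ge> N" "inverse (real (Suc m)) < \<eta>" using large by blast
    obtain j where j: "j \<ge> m" "\<forall>i\<in>factorial_block j.
        \<delta> \<le> dist (time_map f (p i) x) (time_map f (p i) y)"
      using far by blast
    have "closeness_average f p x y \<delta> (fact (Suc j)) \<le> inverse (real (Suc j))"
      unfolding ratio[symmetric]
      by (rule closeness_average_block(2)[OF le]) (use j in \<open>simp add: factorial_block_def del: fact_Suc\<close>)
    then have "closeness_average f p x y \<delta> (fact (Suc j)) < \<eta>"
      using m(2) mono[OF j(1)] by linarith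
    moreover have "N \<le> fact (Suc j)" using index[of N j] m(1) j(1) by linarith
    ultimately show "\<exists>n\<ge>N. closeness_average f p x y \<delta> n < \<eta>" by blast
  qed
qed

lemma factorial_block_unique:
  assumes "i \<in> factorial_block j" "i \<in> factorial_block k"
  shows "j = k"
proof (rule ccontr)
  assume "j \<noteq> k"
  then consider "Suc j \<le> k" | "Suc k \<le> j" by linarith
  then show False
    using assms fact_mono_nat[of "Suc j" k] fact_mono_nat[of "Suc k" j]
    unfolding factorial_block_def atLeastLessThan_iff by (cases; linarith)
qed

section \<open>Li-Yorke chaos implies distributional chaos\<close>

text \<open>The constant \<open>\<delta>\<close> is preserved: a Li-Yorke pair is separated by strictly more than \<open>\<delta>\<close> infinitely
  often, and this strictness makes separation an open condition that persists for nearby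
  pairs.\<close>

lemma distributionally_chaotic_of_Li_Yorke_chaotic:
  fixes X :: "'a::metric_space set" and f :: "nat \<Rightarrow> 'a \<Rightarrow> 'a"
  assumes X: "compact X" "\<And>n. f n ` X \<subseteq> X" "\<And>n. continuous_on X (f n)"
    and "\<delta> > 0" "Li_Yorke_chaotic X f \<delta>"
  shows "\<exists>q. strict_mono q \<and> distributionally_chaotic X f \<delta> q"
proof -
  define \<rho> where "\<rho> n x y = dist (time_map f n x) (time_map f n y)" for n x y
  obtain S where S: "uncountable S" "Li_Yorke_scrambled X f \<delta> S"
    using assms(5) unfolding Li_Yorke_chaotic_def by blast
  have "S \<subseteq> X" using S(2) unfolding Li_Yorke_scrambled_def by blast
  obtain D where D: "D \<subseteq> S" "countable D" "D \<noteq> {}" "\<forall>d\<in>D. d islimpt D"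
    using countable_dense_in_itself_subset[OF X(1) \<open>S \<subseteq> X\<close> S(1)] by blast
  have proximal: "\<exists>\<^sub>F n in sequentially. \<rho> n a b < \<epsilon>"
    and separated: "\<exists>\<^sub>F n in sequentially. \<delta> < \<rho> n a b"
    if "a \<in> D" "b \<in> D" "a \<noteq> b" "\<epsilon> > 0" for a b \<epsilon>
  proof -
    have "liminf (\<lambda>n. ereal (\<rho> n a b)) = 0" "limsup (\<lambda>n. ereal (\<rho> n a b)) > ereal \<delta>"
      using that D(1) S(2) unfolding Li_Yorke_scrambled_def \<rho>_def by blast+
    then show "\<exists>\<^sub>F n in sequentially. \<rho> n a b < \<epsilon>" "\<exists>\<^sub>F n in sequentially. \<delta> < \<rho> n a b"
      using liminf_eq_0_iff_frequently_small[of "\<lambda>n. \<rho> n a b"] that(4) limsup_greater_imp_frequently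
      by (auto simp: \<rho>_def)
  qed
  \<comment> \<open>The Boolean says whether the task is to bring the pair together or to separate it.\<close>
  let ?A = "{(a, b). a \<in> D \<and> b \<in> D \<and> a \<noteq> b} \<times> (UNIV :: bool set)"
  have "countable ?A"
    by (rule countable_subset[of _ "(D \<times> D) \<times> UNIV"]) (use D(2) in auto)
  moreover have "?A \<noteq> {}"
  proof -
    obtain d where "d \<in> D" using D(3) by blast
    moreover from this obtain d' where "d' \<in> D" "d' \<noteq> d"
      using D(4) islimpt_approachable zero_less_one by metis
    ultimately show ?thesis by blast
  qed
  ultimately obtain e :: "nat \<Rightarrow> ('a \<times> 'a) \<times> bool" where
    e: "range e \<subseteq> ?A" "\<forall>z\<in>?A. \<exists>\<^sub>F n in sequentially. e n = z"
    using enumeration_infinitely_often by blast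
  define good where "good j x y t =
    (if snd (e j) then \<rho> t x y < inverse (real (Suc j)) else \<delta> < \<rho> t x y)" for j x y t
  \<comment> \<open>The times admissible at index \<open>i\<close>. An index lies in at most one block, so \<open>T i\<close> imposes at most
    one task and is infinite.\<close>
  define T where "T i = {t. \<forall>j. i \<in> factorial_block j \<longrightarrow>
      good j (fst (fst (e j))) (snd (fst (e j))) t}" for i :: nat
  have "infinite (T i)" for i
  proof (cases "\<exists>j. i \<in> factorial_block j")
    case True
    then obtain j where j: "i \<in> factorial_block j" by blast
    obtain a b \<beta> where ej: "e j = ((a, b), \<beta>)" by (metis surj_pair)
    with e(1) have ab: "a \<in> D" "b \<in> D" "a \<noteq> b" by (metis (mono_tags, lifting) SigmaD1 case_prodD mem_Collect_eq rangeI subsetD)+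
    have "T i = {t. good j a b t}"
      using j ej unfolding T_def by (auto dest: factorial_block_unique[OF _ j])
    moreover have "\<exists>\<^sub>F t in sequentially. good j a b t"
      using proximal[OF ab, of "inverse (real (Suc j))"] separated[OF ab zero_less_one]
      unfolding good_def by (cases "snd (e j)") simp_all
    ultimately show ?thesis by (simp add: frequently_cofinite[symmetric] cofinite_eq_sequentially)
  next
    case False
    then have "T i = UNIV" unfolding T_def by blast
    then show ?thesis by simp
  qed
  then obtain p where p: "strict_mono p" "\<And>i. p i \<in> T i"
    using strict_mono_selection by blast
  have p_good: "good j a b (p i)" if "e j = ((a, b), \<beta>)" "i \<in> factorial_block j" for i j a b \<beta>
    using p(2)[of i] that unfolding T_def by (metis (no_types, lifting) fst_conv mem_Collect_eq snd_conv)
  \<comment> \<open>A pair related by all \<open>R (\<beta>, m)\<close> succeeds on infinitely many blocks of each kind. The task of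
    such a block may have been set for another pair of points.\<close>
  define R where "R z x y \<longleftrightarrow>
    (\<exists>j\<ge>snd z. snd (e j) = fst z \<and> (\<forall>i\<in>factorial_block j. good j x y (p i)))"
    for z :: "bool \<times> nat" and x y
  define K where "K = closure D"
  have "K \<subseteq> X"
    unfolding K_def using D(1) \<open>S \<subseteq> X\<close> X(1) by (simp add: closure_minimal compact_imp_closed)
  have "\<exists>C\<subseteq>K. uncountable C \<and> (\<forall>x\<in>C. \<forall>y\<in>C. x \<noteq> y \<longrightarrow> (\<forall>z. R z x y))"
  proof (rule uncountable_scrambled_set_of_open_relations)
    show "compact K"
      using X(1) \<open>K \<subseteq> X\<close> unfolding K_def by (metis closed_closure compact_Int_closed inf_absorb2)
    show "K \<noteq> {}" "countable D" "D \<subseteq> K" "K \<subseteq> closure D"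
      using D closure_subset unfolding K_def by auto
    show "R z y x" if "R z x y" for z x y
    proof -
      have "good j y x t = good j x y t" for j t
        unfolding good_def \<rho>_def by (simp add: dist_commute)
      with that show ?thesis unfolding R_def by simp
    qed
    show "\<exists>z. \<not> R z x x" for x
    proof (intro exI notI)
      \<comment> \<open>Index \<open>m = 1\<close> rather than \<open>0\<close>, since success on the empty block is vacuous.\<close>
      assume "R (False, 1) x x"
      then obtain j where "j \<ge> 1" "\<not> snd (e j)" and
        *: "\<And>i. i \<in> factorial_block j \<Longrightarrow> good j x x (p i)"
        unfolding R_def by auto
      have "fact j \<in> factorial_block j" using \<open>j \<ge> 1\<close> by (simp add: factorial_block_def)
      from *[OF this] show False using \<open>\<not> snd (e j)\<close> \<open>\<delta> > 0\<close> unfolding good_def \<rho>_def by simp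
    qed
    show "openin (top_of_set K) {y \<in> K. R z x y}" if "x \<in> K" for z x
    proof -
      have good_open: "openin (top_of_set K) {y \<in> K. good j x y t}" for j t
      proof -
        have cont: "continuous_on K (\<lambda>y. \<rho> t x y)"
          unfolding \<rho>_def
          by (intro continuous_intros
              continuous_on_subset[OF continuous_on_time_map[of f X t, OF X(2,3)] \<open>K \<subseteq> X\<close>])
        have "openin (top_of_set K) (K \<inter> (\<lambda>y. \<rho> t x y) -` {..<inverse (real (Suc j))})"
          "openin (top_of_set K) (K \<inter> (\<lambda>y. \<rho> t x y) -` {\<delta><..})"
          by (rule continuous_openin_preimage_gen[OF cont]; simp)+
        then show ?thesis
          unfolding good_def by (cases "snd (e j)") (simp_all add: vimage_def Int_def)
      qed
      have block_open: "openin (top_of_set K) (K \<inter> (\<Inter>i\<in>factorial_block j. {y \<in> K. good j x y (p i)}))" for j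
        using good_open by (cases "factorial_block j = {}")
          (auto simp: factorial_block_def simp del: fact_Suc intro!: openin_Int openin_INT2)
      have union: "{y \<in> K. R z x y} = (\<Union>j\<in>{j. j \<ge> snd z \<and> snd (e j) = fst z}.
          K \<inter> (\<Inter>i\<in>factorial_block j. {y \<in> K. good j x y (p i)}))"
        unfolding R_def by auto
      show ?thesis unfolding union by (rule openin_Union) (use block_open in blast)
    qed
    show "K \<subseteq> closure {y \<in> K. R z d y}" if "d \<in> D" for z d
    proof -
      \<comment> \<open>The point \<open>d\<close> is a limit of other points of \<open>D\<close>, and the pairs that it forms with them are
        served by the sequence.\<close>
      have "R z d d'" if "d' \<in> D - {d}" for d'
      proof -
        have "\<exists>\<^sub>F j in sequentially. e j = ((d, d'), fst z)" using e(2) \<open>d \<in> D\<close> that by auto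
        then obtain j where "j \<ge> snd z" "e j = ((d, d'), fst z)"
          unfolding frequently_sequentially by blast
        then show ?thesis using p_good unfolding R_def by (metis snd_conv)
      qed
      then have "D - {d} \<subseteq> {y \<in> K. R z d y}" unfolding K_def using closure_subset by blast
      moreover have "D \<subseteq> closure (D - {d})"
        using D(4) \<open>d \<in> D\<close> closure_subset[of "D - {d}"] by (auto simp: islimpt_in_closure)
      ultimately show ?thesis
        unfolding K_def by (meson closed_closure closure_minimal closure_mono order_trans)
    qed
  qed
  then obtain C where C: "C \<subseteq> K" "uncountable C" "\<forall>x\<in>C. \<forall>y\<in>C. x \<noteq> y \<longrightarrow> (\<forall>z. R z x y)" by blast
  have "(\<forall>\<epsilon>>0. upper_distribution f p x y \<epsilon> = 1) \<and> lower_distribution f p x y \<delta> = 0"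
    if "x \<in> C" "y \<in> C" "x \<noteq> y" for x y
  proof -
    have Rxy: "R z x y" for z using C(3) that by blast
    have "\<exists>j\<ge>m. \<forall>i\<in>factorial_block j. \<rho> (p i) x y < inverse (real (Suc j))" for m
      using Rxy[of "(True, m)"] unfolding R_def good_def by auto
    moreover have "\<exists>j\<ge>m. \<forall>i\<in>factorial_block j. \<delta> \<le> \<rho> (p i) x y" for m
      using Rxy[of "(False, m)"] unfolding R_def good_def by force
    ultimately show ?thesis
      using distributions_of_factorial_blocks[of f p x y \<delta>] unfolding \<rho>_def by blast
  qed
  moreover have "\<exists>x\<in>C. \<exists>y\<in>C. x \<noteq> y"
    using C(2) by (metis countable_empty countable_insert subset_singletonD subsetI countable_subset insertCI)
  ultimately have "distributionally_scrambled X f \<delta> p C"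
    using C(1) \<open>K \<subseteq> X\<close> unfolding distributionally_scrambled_def by blast
  with C(2) p(1) show ?thesis unfolding distributionally_chaotic_def by blast
qed

theorem theorem3p6:
  fixes X :: "'a::metric_space set"
    and f :: "nat \<Rightarrow> 'a \<Rightarrow> 'a"
  assumes "compact X"
    and "\<And>n. f n ` X \<subseteq> X"
    and "\<And>n. continuous_on X (f n)"
  shows "(\<exists>\<delta>>0. Li_Yorke_chaotic X f \<delta>) \<longleftrightarrow>
         (\<exists>\<delta>'>0. \<exists>q. strict_mono q \<and> distributionally_chaotic X f \<delta>' q)"
proof
  assume "\<exists>\<delta>>0. Li_Yorke_chaotic X f \<delta>"
  then show "\<exists>\<delta>'>0. \<exists>q. strict_mono q \<and> distributionally_chaotic X f \<delta>' q"
    using distributionally_chaotic_of_Li_Yorke_chaotic[of X f, OF assms] by blast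
next
  assume "\<exists>\<delta>'>0. \<exists>q. strict_mono q \<and> distributionally_chaotic X f \<delta>' q"
  then obtain \<delta>' q where "\<delta>' > 0" "strict_mono q" "distributionally_chaotic X f \<delta>' q" by blast
  then have "Li_Yorke_chaotic X f (\<delta>' / 2)"
    using Li_Yorke_chaotic_of_distributionally_chaotic[of q X f \<delta>' "\<delta>' / 2"] by simp
  with \<open>\<delta>' > 0\<close> show "\<exists>\<delta>>0. Li_Yorke_chaotic X f \<delta>" by (intro exI[of _ "\<delta>' / 2"]) simp
qed

end
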